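(* The threshold algorithm TA requires only bounded buffers, whose size is independent of the size of the database; that is, for fixed $m$, $k$ and aggregation function $t$, TA can be carried out while storing at any time only a number of objects, grades and pointers into the lists that is bounded by a constant independent of the number $N$ of objects in the database.
   Context: Setting: fix positive integers $m$ and $k$ (treated as constants). A database consists of a finite set of $N\ge k$ objects; each object $R$ has $m$ grades $x_1,\dots,x_m\in[0,1]$. It is presented as $m$ sorted lists $L_1,\dots,L_m$ of length $N$; list $L_i$ contains one entry $(R,x_i)$ for each object $R$, in descending order of $x_i$. An aggregation function is a fixed function $t:[0,1]^m\to[0,\infty)$; the overall grade of $R$ is $t(R)=t(x_1,\dots,x_m)$. Sorted access means reading the next entry of some list, proceeding sequentially from the top; random access means requesting the grade of a given object in a given list, obtained in one step. Algorithm TA: (1) Do sorted access in parallel to each of the $m$ lists (top entry of each list, then second entry of each list, and so on). As an object $R$ is seen under sorted access in some list, do random access to the other lists to find all its grades (this is done even if some of these grades were already determined earlier), and compute $t(R)$. If this grade is one of the $k$ highest seen, remember $R$ and $t(R)$ (ties broken arbitrarily, so that only $k$ objects and their grades need be remembered at any time). (2) For each $i$ let $\underline{x}_i$ be the grade of the last object seen under sorted access in $L_i$, and let the threshold value be $\tau=t(\underline{x}_1,\dots,\underline{x}_m)$. As soon as at least $k$ objects have been seen whose grade is at least $\tau$, halt. (3) Output the $k$ seen objects with highest grades, with their grades. *)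

theory Defs
  imports Complex_Main
begin

section \<open>Databases\<close>

text \<open>The lists \<open>L\<^sub>1, \<dots>, L\<^sub>m\<close> are numbered \<open>0, \<dots>, m - 1\<close>. An aggregation function takes
  the list of the \<open>m\<close> grades; its values on other arguments are irrelevant.\<close>

record 'o database =
  objects :: "'o set"
  grade :: "'o \<Rightarrow> nat \<Rightarrow> real"
  slists :: "('o \<times> real) list list"

definition is_database :: "nat \<Rightarrow> 'o database \<Rightarrow> bool" where
  "is_database m db \<longleftrightarrow>
     finite (objects db) \<and>
     (\<forall>R\<in>objects db. \<forall>i<m. 0 \<le> grade db R i \<and> grade db R i \<le> 1) \<and>
     length (slists db) = m \<and>
     (\<forall>i<m. distinct (map fst (slists db ! i)) \<and>
            set (slists db ! i) = {(R, grade db R i) | R. R \<in> objects db} \<and>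
            sorted_wrt (\<ge>) (map snd (slists db ! i)))"

definition overall :: "(real list \<Rightarrow> real) \<Rightarrow> nat \<Rightarrow> 'o database \<Rightarrow> 'o \<Rightarrow> real" where
  "overall t m db R = t (map (grade db R) [0..<m])"

text \<open>What an algorithm observably does: its accesses together with their answers, and the
  pairs of an object and its overall grade that it outputs.\<close>

datatype 'o event =
    Sorted_Access nat 'o real
  | Random_Access nat 'o real
  | Output 'o real


section \<open>The threshold algorithm\<close>

text \<open>The algorithm is specified with access to its whole history: \<open>S\<close> is the set of all objects
  seen so far under sorted access and \<open>Y\<close> the set of remembered objects. Ties are broken
  arbitrarily, so the specification is a relation.\<close>

text \<open>\<open>Y\<close> consists of \<open>k\<close> objects of \<open>S\<close> with highest value under \<open>f\<close>, or of all of \<open>S\<close> as long as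
  \<open>S\<close> has fewer than \<open>k\<close> elements.\<close>

definition highest :: "nat \<Rightarrow> ('o \<Rightarrow> real) \<Rightarrow> 'o set \<Rightarrow> 'o set \<Rightarrow> bool" where
  "highest k f S Y \<longleftrightarrow>
     Y \<subseteq> S \<and> card Y = min k (card S) \<and> (\<forall>a\<in>Y. \<forall>b\<in>S - Y. f b \<le> f a)"

text \<open>One sorted access, to the entry at depth \<open>d\<close> of list \<open>i\<close>, with the random accesses it
  triggers. An object may be forgotten but never remembered again without being seen again.\<close>

inductive ta_visit ::
  "(real list \<Rightarrow> real) \<Rightarrow> nat \<Rightarrow> nat \<Rightarrow> 'o database \<Rightarrow> nat \<Rightarrow> nat \<Rightarrow>
   'o set \<times> 'o set \<Rightarrow> 'o event list \<Rightarrow> 'o set \<times> 'o set \<Rightarrow> bool"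
  for t m k db where
  "slists db ! i ! d = (R, x) \<Longrightarrow>
   highest k (overall t m db) (insert R S) Y' \<Longrightarrow>
   Y' \<subseteq> insert R Y \<Longrightarrow>
   ta_visit t m k db d i (S, Y)
     (Sorted_Access i R x #
      map (\<lambda>j. Random_Access j R (grade db R j)) (filter (\<lambda>j. j \<noteq> i) [0..<m]))
     (insert R S, Y')"

inductive ta_visits ::
  "(real list \<Rightarrow> real) \<Rightarrow> nat \<Rightarrow> nat \<Rightarrow> 'o database \<Rightarrow> nat \<Rightarrow> nat list \<Rightarrow>
   'o set \<times> 'o set \<Rightarrow> 'o event list \<Rightarrow> 'o set \<times> 'o set \<Rightarrow> bool"
  for t m k db d where
  "ta_visits t m k db d [] \<sigma> [] \<sigma>"
| "ta_visit t m k db d i \<sigma> es \<sigma>' \<Longrightarrow> ta_visits t m k db d is \<sigma>' es' \<sigma>'' \<Longrightarrow>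
   ta_visits t m k db d (i # is) \<sigma> (es @ es') \<sigma>''"

definition threshold :: "(real list \<Rightarrow> real) \<Rightarrow> nat \<Rightarrow> 'o database \<Rightarrow> nat \<Rightarrow> real" where
  "threshold t m db d = t (map (\<lambda>i. snd (slists db ! i ! d)) [0..<m])"

text \<open>The test after the round that reads the entries at depth \<open>d\<close>. Since \<open>t\<close> is not assumed to be
  monotone, the threshold test may fail even when all objects have been seen; as no further sorted
  access is possible then, the algorithm stops in this case as well.\<close>

definition ta_halts ::
  "(real list \<Rightarrow> real) \<Rightarrow> nat \<Rightarrow> nat \<Rightarrow> 'o database \<Rightarrow> nat \<Rightarrow> 'o set \<Rightarrow> bool" where
  "ta_halts t m k db d S \<longleftrightarrow>
     k \<le> card {R \<in> S. threshold t m db d \<le> overall t m db R} \<or>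
     Suc d = card (objects db)"

text \<open>The runs from the round at depth \<open>d\<close> on. A round accesses the \<open>m\<close> lists in parallel, which is
  serialised as list \<open>0\<close> to list \<open>m - 1\<close>.\<close>

inductive ta_rounds ::
  "(real list \<Rightarrow> real) \<Rightarrow> nat \<Rightarrow> nat \<Rightarrow> 'o database \<Rightarrow> nat \<Rightarrow>
   'o set \<times> 'o set \<Rightarrow> 'o event list \<Rightarrow> bool"
  for t m k db where
  halt:
  "ta_visits t m k db d [0..<m] \<sigma> es (S, Y) \<Longrightarrow> ta_halts t m k db d S \<Longrightarrow>
   distinct Rs \<Longrightarrow> set Rs = Y \<Longrightarrow>
   ta_rounds t m k db d \<sigma> (es @ map (\<lambda>R. Output R (overall t m db R)) Rs)"
| continue:
  "ta_visits t m k db d [0..<m] \<sigma> es (S, Y) \<Longrightarrow> \<not> ta_halts t m k db d S \<Longrightarrow>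
   ta_rounds t m k db (Suc d) (S, Y) es' \<Longrightarrow>
   ta_rounds t m k db d \<sigma> (es @ es')"

definition ta_run ::
  "(real list \<Rightarrow> real) \<Rightarrow> nat \<Rightarrow> nat \<Rightarrow> 'o database \<Rightarrow> 'o event list \<Rightarrow> bool" where
  "ta_run t m k db es \<longleftrightarrow> ta_rounds t m k db 0 ({}, {}) es"


section \<open>Programs with explicit storage\<close>

text \<open>The storage holds one pointer into each sorted list (the number of entries already read),
  and cells for objects and for grades. Programs can use objects only by testing them for equality
  and by random access, and grades only by comparing them and by aggregation, so neither objects
  nor grades nor pointers can be misused to encode other data. Programs mention neither objects nor
  numbers taken from the database. The only further state is the position in the program text,
  i.e. the command that remains to be executed; it ranges over a finite set determined by the
  program alone.\<close>

record 'o store =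
  pointers :: "nat list"
  ocells :: "nat \<Rightarrow> 'o option"
  gcells :: "nat \<Rightarrow> real option"

definition init_store :: "nat \<Rightarrow> 'o store" where
  "init_store m = \<lparr>pointers = replicate m 0, ocells = (\<lambda>_. None), gcells = (\<lambda>_. None)\<rparr>"

text \<open>Finiteness is part of the definition since \<^const>\<open>card\<close> is 0 on infinite sets.\<close>

definition stores_at_most :: "nat \<Rightarrow> 'o store \<Rightarrow> bool" where
  "stores_at_most B s \<longleftrightarrow>
     finite (dom (ocells s)) \<and> finite (dom (gcells s)) \<and>
     length (pointers s) + card (dom (ocells s)) + card (dom (gcells s)) \<le> B"

datatype test =
    More_Entries nat
  | Used nat
  | Same_Object nat nat
  | Grade_Le nat nat
  | Neg test
  | Conj test test

text \<open>\<open>Used\<close> refers to object cells. Comparisons involving an empty cell are false.\<close>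

primrec holds :: "'o database \<Rightarrow> 'o store \<Rightarrow> test \<Rightarrow> bool" where
  "holds db s (More_Entries i) \<longleftrightarrow>
     i < length (pointers s) \<and> pointers s ! i < length (slists db ! i)"
| "holds db s (Used a) \<longleftrightarrow> ocells s a \<noteq> None"
| "holds db s (Same_Object a b) \<longleftrightarrow> (\<exists>R. ocells s a = Some R \<and> ocells s b = Some R)"
| "holds db s (Grade_Le a b) \<longleftrightarrow> (\<exists>x y. gcells s a = Some x \<and> gcells s b = Some y \<and> x \<le> y)"
| "holds db s (Neg p) \<longleftrightarrow> \<not> holds db s p"
| "holds db s (Conj p q) \<longleftrightarrow> holds db s p \<and> holds db s q"

datatype com =
    SKIP
  | READ nat nat nat            \<comment> \<open>\<open>READ i a b\<close>: sorted access to list \<open>i\<close> into object cell \<open>a\<close>, grade cell \<open>b\<close>\<close>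
  | LOOKUP nat nat nat          \<comment> \<open>\<open>LOOKUP j a b\<close>: random access to list \<open>j\<close> for object cell \<open>a\<close> into grade cell \<open>b\<close>\<close>
  | AGGREGATE "nat list" nat    \<comment> \<open>\<open>AGGREGATE bs b\<close>: apply \<open>t\<close> to the grade cells \<open>bs\<close>, result into grade cell \<open>b\<close>\<close>
  | COPY_OBJECT nat nat         \<comment> \<open>source cell, target cell\<close>
  | COPY_GRADE nat nat
  | OUTPUT nat nat              \<comment> \<open>object cell, grade cell\<close>
  | SEQ com com
  | IF test com com
  | WHILE test com

text \<open>The semantics is deterministic, see below. Instructions are stuck when they need the contents
  of an empty cell (copying may copy emptiness), when a list is exhausted, and when \<open>t\<close> would be
  applied outside of its domain \<open>[0,1]\<^sup>m\<close>.\<close>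

inductive small_step ::
  "(real list \<Rightarrow> real) \<Rightarrow> 'o database \<Rightarrow> com \<times> 'o store \<Rightarrow> 'o event list \<Rightarrow> com \<times> 'o store \<Rightarrow> bool"
  for t db where
  Read:
  "i < length (pointers s) \<Longrightarrow> pointers s ! i = n \<Longrightarrow> n < length (slists db ! i) \<Longrightarrow>
   slists db ! i ! n = (R, x) \<Longrightarrow>
   small_step t db (READ i a b, s) [Sorted_Access i R x]
     (SKIP, s\<lparr>pointers := (pointers s)[i := Suc n], ocells := (ocells s)(a \<mapsto> R),
              gcells := (gcells s)(b \<mapsto> x)\<rparr>)"
| Lookup:
  "j < length (slists db) \<Longrightarrow> ocells s a = Some R \<Longrightarrow>
   small_step t db (LOOKUP j a b, s) [Random_Access j R (grade db R j)]
     (SKIP, s\<lparr>gcells := (gcells s)(b \<mapsto> grade db R j)\<rparr>)"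
| Aggregate:
  "length bs = length (slists db) \<Longrightarrow> map (gcells s) bs = map Some xs \<Longrightarrow> set xs \<subseteq> {0..1} \<Longrightarrow>
   small_step t db (AGGREGATE bs b, s) [] (SKIP, s\<lparr>gcells := (gcells s)(b \<mapsto> t xs)\<rparr>)"
| Copy_Object:
  "small_step t db (COPY_OBJECT a b, s) []
     (SKIP, s\<lparr>ocells := (ocells s)(b := ocells s a)\<rparr>)"
| Copy_Grade:
  "small_step t db (COPY_GRADE a b, s) []
     (SKIP, s\<lparr>gcells := (gcells s)(b := gcells s a)\<rparr>)"
| Output:
  "ocells s a = Some R \<Longrightarrow> gcells s b = Some x \<Longrightarrow>
   small_step t db (OUTPUT a b, s) [Output R x] (SKIP, s)"
| Seq_Skip: "small_step t db (SEQ SKIP c, s) [] (c, s)"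
| Seq:
  "small_step t db (c1, s) es (c1', s') \<Longrightarrow>
   small_step t db (SEQ c1 c2, s) es (SEQ c1' c2, s')"
| If_True: "holds db s p \<Longrightarrow> small_step t db (IF p c1 c2, s) [] (c1, s)"
| If_False: "\<not> holds db s p \<Longrightarrow> small_step t db (IF p c1 c2, s) [] (c2, s)"
| While: "small_step t db (WHILE p c, s) [] (IF p (SEQ c (WHILE p c)) SKIP, s)"

inductive exec ::
  "(real list \<Rightarrow> real) \<Rightarrow> 'o database \<Rightarrow> com \<times> 'o store \<Rightarrow> 'o event list \<Rightarrow> com \<times> 'o store \<Rightarrow> bool"
  for t db where
  refl: "exec t db cs [] cs"
| step: "small_step t db cs es cs' \<Longrightarrow> exec t db cs' es' cs'' \<Longrightarrow> exec t db cs (es @ es') cs''"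

inductive_cases small_step_cases:
  "small_step t db (SKIP, s) es cs"
  "small_step t db (READ i a b, s) es cs"
  "small_step t db (LOOKUP i a b, s) es cs"
  "small_step t db (AGGREGATE bs b, s) es cs"
  "small_step t db (COPY_OBJECT a b, s) es cs"
  "small_step t db (COPY_GRADE a b, s) es cs"
  "small_step t db (OUTPUT a b, s) es cs"
  "small_step t db (SEQ c1 c2, s) es cs"
  "small_step t db (IF p c1 c2, s) es cs"
  "small_step t db (WHILE p c, s) es cs"

lemma small_step_deterministic:
  "small_step t db cs es cs' \<Longrightarrow> small_step t db cs es' cs'' \<Longrightarrow> es' = es \<and> cs'' = cs'"
proof (induction cs es cs' arbitrary: es' cs'' rule: small_step.induct)
  case (Seq c1 s es c1' s' c2)
  from Seq.prems show ?case
  proof (rule small_step_cases(8))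
    assume "c1 = SKIP"
    with Seq.hyps have "small_step t db (SKIP, s) es (c1', s')"
      by simp
    then show ?thesis
      by (rule small_step_cases(1))
  next
    fix d s''
    assume "cs'' = (SEQ d c2, s'')" "small_step t db (c1, s) es' (d, s'')"
    then show ?thesis
      using Seq.IH by blast
  qed
next
  case (Seq_Skip c s)
  from Seq_Skip.prems show ?case
    by (rule small_step_cases(8)) (blast elim: small_step_cases(1))+
next
  case (Aggregate bs s xs b)
  from Aggregate.prems show ?case
  proof (rule small_step_cases(4))
    fix ys
    assume step: "es' = []" "cs'' = (SKIP, s\<lparr>gcells := (gcells s)(b \<mapsto> t ys)\<rparr>)"
      and "map (gcells s) bs = map Some ys"
    with Aggregate.hyps have "map Some ys = map Some xs"
      by simp
    then have "ys = xs"
      by (rule map_injective) simp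
    then show ?thesis
      using step by simp
  qed
next
  case (Read i s n R x a b)
  from Read.prems show ?case
    by (rule small_step_cases(2)) (simp add: Read.hyps)
next
  case (Lookup j s a R b)
  from Lookup.prems show ?case
    by (rule small_step_cases(3)) (simp add: Lookup.hyps)
next
  case (Copy_Object a b s)
  then show ?case
    by (rule small_step_cases(5)) simp
next
  case (Copy_Grade a b s)
  then show ?case
    by (rule small_step_cases(6)) simp
next
  case (Output s a R b x)
  from Output.prems show ?case
    by (rule small_step_cases(7)) (simp add: Output.hyps)
next
  case (If_True s p c1 c2)
  from If_True.prems show ?case
    by (rule small_step_cases(9)) (simp_all add: If_True.hyps)
next
  case (If_False s p c1 c2)
  from If_False.prems show ?case
    by (rule small_step_cases(9)) (simp_all add: If_False.hyps)
next
  case (While p c s)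
  then show ?case
    by (rule small_step_cases(10)) simp
qed

text \<open>A program carries out the threshold algorithm on a database with \<open>m\<close> lists if it terminates
  properly and the accesses and outputs it makes are those of a run of the algorithm.\<close>

definition carries_out_TA ::
  "(real list \<Rightarrow> real) \<Rightarrow> nat \<Rightarrow> nat \<Rightarrow> 'o database \<Rightarrow> com \<Rightarrow> bool" where
  "carries_out_TA t m k db P \<longleftrightarrow>
     (\<exists>es s. exec t db (P, init_store m) es (SKIP, s) \<and> ta_run t m k db es)"

end

theory Submission
  imports Defs
begin

text \<open>A program writes only the finitely many cells named in its text, so its storage is bounded by
  a number read off the program, and it suffices to write the algorithm as a program. The \<open>k\<close>
  remembered objects replace the whole history \<open>S\<close>: a newly seen object that is not among them is
  carried through the buffer and exchanged with every entry of smaller grade, so that the one finally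
  dropped has the lowest grade of all; an object that was dropped earlier is thereby dropped again.
  At least \<open>k\<close> objects of \<open>S\<close> reach the threshold iff the buffer is full and all of its
  entries do.\<close>

section \<open>Every program has bounded storage\<close>

primrec object_targets :: "com \<Rightarrow> nat set" where
  "object_targets SKIP = {}"
| "object_targets (READ i a b) = {a}"
| "object_targets (LOOKUP j a b) = {}"
| "object_targets (AGGREGATE bs b) = {}"
| "object_targets (COPY_OBJECT a b) = {b}"
| "object_targets (COPY_GRADE a b) = {}"
| "object_targets (OUTPUT a b) = {}"
| "object_targets (SEQ c1 c2) = object_targets c1 \<union> object_targets c2"
| "object_targets (IF p c1 c2) = object_targets c1 \<union> object_targets c2"
| "object_targets (WHILE p c) = object_targets c"

primrec grade_targets :: "com \<Rightarrow> nat set" where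
  "grade_targets SKIP = {}"
| "grade_targets (READ i a b) = {b}"
| "grade_targets (LOOKUP j a b) = {b}"
| "grade_targets (AGGREGATE bs b) = {b}"
| "grade_targets (COPY_OBJECT a b) = {}"
| "grade_targets (COPY_GRADE a b) = {b}"
| "grade_targets (OUTPUT a b) = {}"
| "grade_targets (SEQ c1 c2) = grade_targets c1 \<union> grade_targets c2"
| "grade_targets (IF p c1 c2) = grade_targets c1 \<union> grade_targets c2"
| "grade_targets (WHILE p c) = grade_targets c"

lemma finite_targets: "finite (object_targets c)" "finite (grade_targets c)"
  by (induction c) auto

text \<open>A write only moves a cell from those the remaining text can still fill to those already
  filled, and unfolding \<open>WHILE\<close> duplicates text without adding targets.\<close>

lemma small_step_targets:
  assumes "small_step t db cs es cs'"
  shows "object_targets (fst cs') \<union> dom (ocells (snd cs'))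
           \<subseteq> object_targets (fst cs) \<union> dom (ocells (snd cs))"
    and "grade_targets (fst cs') \<union> dom (gcells (snd cs'))
           \<subseteq> grade_targets (fst cs) \<union> dom (gcells (snd cs))"
    and "length (pointers (snd cs')) = length (pointers (snd cs))"
  using assms by (induction rule: small_step.induct) (auto split: if_splits)

lemma exec_targets:
  assumes "exec t db cs es cs'"
  shows "object_targets (fst cs') \<union> dom (ocells (snd cs'))
           \<subseteq> object_targets (fst cs) \<union> dom (ocells (snd cs))"
    and "grade_targets (fst cs') \<union> dom (gcells (snd cs'))
           \<subseteq> grade_targets (fst cs) \<union> dom (gcells (snd cs))"
    and "length (pointers (snd cs')) = length (pointers (snd cs))"
  using assms
proof (induction rule: exec.induct)
  case (step cs es cs' es' cs'')
  note targets = small_step_targets[OF step.hyps(1)]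
  { case 1 show ?case using step.IH(1) targets(1) by (rule order_trans) }
  { case 2 show ?case using step.IH(2) targets(2) by (rule order_trans) }
  { case 3 show ?case using step.IH(3) targets(3) by simp }
qed simp_all

text \<open>The initial domains are empty, so the invariant leaves only the targets of
  \<open>P\<close>. The remaining command \<open>c\<close> is arbitrary, which covers every
  intermediate configuration.\<close>

lemma exec_stores_at_most:
  assumes "exec t db (P, init_store m) es (c, s)"
  shows "stores_at_most (m + card (object_targets P) + card (grade_targets P)) s"
proof -
  have "dom (ocells s) \<subseteq> object_targets P" "dom (gcells s) \<subseteq> grade_targets P"
    and "length (pointers s) = m"
    using exec_targets[OF assms] by (simp_all add: init_store_def)
  then show ?thesis
    unfolding stores_at_most_def
    by (auto intro!: add_mono card_mono finite_targets intro: finite_subset[OF _ finite_targets(1)]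
        finite_subset[OF _ finite_targets(2)])
qed


section \<open>Terminating executions\<close>

abbreviation run ::
  "(real list \<Rightarrow> real) \<Rightarrow> 'o database \<Rightarrow> com \<Rightarrow> 'o store \<Rightarrow> 'o event list \<Rightarrow> 'o store \<Rightarrow> bool"
  where "run t db c s es s' \<equiv> exec t db (c, s) es (SKIP, s')"

lemma exec_single: "small_step t db cs es cs' \<Longrightarrow> exec t db cs es cs'"
  using exec.step[OF _ exec.refl] by fastforce

lemma exec_trans:
  "exec t db cs es cs' \<Longrightarrow> exec t db cs' es' cs'' \<Longrightarrow> exec t db cs (es @ es') cs''"
  by (induction rule: exec.induct) (auto intro: exec.step)

lemma exec_SEQ:
  "exec t db cs es cs' \<Longrightarrow> exec t db (SEQ (fst cs) c, snd cs) es (SEQ (fst cs') c, snd cs')"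
proof (induction rule: exec.induct)
  case (step cs es cs' es' cs'')
  then show ?case
    by (metis exec.step small_step.Seq prod.collapse)
qed (rule exec.refl)

lemma run_SEQ:
  assumes "run t db c1 s es s'" "run t db c2 s' es' s''"
  shows "run t db (SEQ c1 c2) s (es @ es') s''"
proof -
  have "exec t db (SEQ c1 c2, s) es (SEQ SKIP c2, s')"
    using exec_SEQ[OF assms(1)] by simp
  moreover have "exec t db (SEQ SKIP c2, s') es' (SKIP, s'')"
    using exec.step[OF Seq_Skip assms(2)] by simp
  ultimately show ?thesis
    by (rule exec_trans)
qed

lemma run_IF:
  "holds db s p \<Longrightarrow> run t db c1 s es s' \<Longrightarrow> run t db (IF p c1 c2) s es s'"
  "\<not> holds db s p \<Longrightarrow> run t db c2 s es s' \<Longrightarrow> run t db (IF p c1 c2) s es s'"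
  using exec.step[OF If_True] exec.step[OF If_False] by fastforce+

lemma run_WHILE_False: "\<not> holds db s p \<Longrightarrow> run t db (WHILE p c) s [] s"
  using exec.step[OF While run_IF(2)[OF _ exec.refl]] by fastforce

lemma run_WHILE_True:
  "holds db s p \<Longrightarrow> run t db (SEQ c (WHILE p c)) s es s' \<Longrightarrow> run t db (WHILE p c) s es s'"
  using exec.step[OF While run_IF(1)] by fastforce

section \<open>Loops unrolled over an index range\<close>

definition SEQS :: "com list \<Rightarrow> com" where
  "SEQS cs = foldr SEQ cs SKIP"

lemma SEQS_simps [simp]: "SEQS [] = SKIP" "SEQS (c # cs) = SEQ c (SEQS cs)"
  by (simp_all add: SEQS_def)

text \<open>An invariant rule for the loops over lists and buffer cells: cells have fixed addresses,
  so each iteration is its own command \<open>c i\<close>. The invariant \<open>I\<close> also sees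
  the events emitted so far.\<close>

lemma run_SEQS_upt:
  assumes step: "\<And>i es s. i < n \<Longrightarrow> I i es s \<Longrightarrow>
      \<exists>es' s'. run t db (c i) s es' s' \<and> I (Suc i) (es @ es') s'"
    and init: "I 0 [] s"
  shows "\<exists>es s'. run t db (SEQS (map c [0..<n])) s es s' \<and> I n es s'"
proof -
  have "\<exists>es' s'. run t db (SEQS (map c [i..<n])) s es' s' \<and> I n (es @ es') s'"
    if "i \<le> n" "I i es s" for i es s
    using that
  proof (induction i arbitrary: es s rule: inc_induct)
    case base
    then show ?case
      by (intro exI[of _ "[]"] exI[of _ s]) (simp add: exec.refl)
  next
    case (step i)
    obtain es1 s1 where 1: "run t db (c i) s es1 s1" "I (Suc i) (es @ es1) s1"
      using assms(1)[OF step.hyps(2) step.prems] by blast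
    obtain es2 s2 where 2: "run t db (SEQS (map c [Suc i..<n])) s1 es2 s2" "I n ((es @ es1) @ es2) s2"
      using step.IH[OF 1(2)] by blast
    show ?case
      using run_SEQ[OF 1(1) 2(1)] 2(2) step.hyps(2)
      by (intro exI[of _ "es1 @ es2"] exI[of _ s2]) (simp add: upt_conv_Cons)
  qed
  from this[of 0 "[]"] init show ?thesis
    by simp
qed

text \<open>The type \<open>test\<close> has no constant truth value, so the empty conjunction needs
  a base test \<open>p\<close>; it is chosen to hold wherever the result matters.\<close>

primrec conj_tests :: "test \<Rightarrow> test list \<Rightarrow> test" where
  "conj_tests p [] = p"
| "conj_tests p (q # qs) = Conj q (conj_tests p qs)"

lemma holds_conj_tests:
  "holds db s (conj_tests p qs) \<longleftrightarrow> holds db s p \<and> (\<forall>q\<in>set qs. holds db s q)"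
  by (induction qs) auto


section \<open>The buffer of remembered objects\<close>

definition contents :: "nat \<Rightarrow> (nat \<Rightarrow> 'o option) \<Rightarrow> 'o set" where
  "contents n oc = {R. \<exists>a<n. oc a = Some R}"

definition unrepeated :: "nat \<Rightarrow> (nat \<Rightarrow> 'o option) \<Rightarrow> bool" where
  "unrepeated n oc \<longleftrightarrow> (\<forall>a<n. \<forall>b<n. \<forall>R. oc a = Some R \<longrightarrow> oc b = Some R \<longrightarrow> a = b)"

lemma card_contents:
  assumes "unrepeated n oc"
  shows "card (contents n oc) = card ({..<n} \<inter> dom oc)"
proof -
  have "contents n oc = (\<lambda>a. the (oc a)) ` ({..<n} \<inter> dom oc)"
    by (force simp: contents_def image_iff)
  moreover have "inj_on (\<lambda>a. the (oc a)) ({..<n} \<inter> dom oc)"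
    using assms by (auto simp: inj_on_def unrepeated_def)
  ultimately show ?thesis
    by (simp add: card_image)
qed

lemma finite_contents: "finite (contents n oc)"
proof -
  have "contents n oc \<subseteq> (\<lambda>a. the (oc a)) ` {..<n}"
    by (force simp: contents_def image_iff)
  then show ?thesis
    by (rule finite_subset) simp
qed

lemma card_contents_le: "unrepeated n oc \<Longrightarrow> card (contents n oc) \<le> n"
  using card_mono[of "{..<n}" "{..<n} \<inter> dom oc"] by (simp add: card_contents)

text \<open>Turns a condition on the number of remembered objects into one on individual cells,
  which comparisons can detect.\<close>

lemma card_contents_full:
  assumes "unrepeated n oc"
  shows "card (contents n oc) = n \<longleftrightarrow> {..<n} \<subseteq> dom oc"
proof
  assume "card (contents n oc) = n"
  then have "{..<n} \<inter> dom oc = {..<n}"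
    using card_contents[OF assms] by (intro card_subset_eq) auto
  then show "{..<n} \<subseteq> dom oc"
    by blast
next
  assume "{..<n} \<subseteq> dom oc"
  then have "{..<n} \<inter> dom oc = {..<n}"
    by blast
  then show "card (contents n oc) = n"
    using card_contents[OF assms] by simp
qed

lemma contents_Suc:
  "contents (Suc n) oc = (case oc n of None \<Rightarrow> contents n oc | Some R \<Rightarrow> insert R (contents n oc))"
  by (auto simp: contents_def less_Suc_eq split: option.split)

lemma unrepeated_Suc:
  "unrepeated (Suc n) oc \<longleftrightarrow> unrepeated n oc \<and> (\<forall>R. oc n = Some R \<longrightarrow> R \<notin> contents n oc)"
proof
  assume L: "unrepeated (Suc n) oc"
  then have "unrepeated n oc"
    by (simp add: unrepeated_def)
  moreover have False if R: "oc n = Some R" and "R \<in> contents n oc" for R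
  proof -
    obtain a where "a < n" "oc a = Some R"
      using \<open>R \<in> contents n oc\<close> by (auto simp: contents_def)
    moreover from this have "a = n"
      using L R unfolding unrepeated_def by (meson less_SucI lessI)
    ultimately show False
      by simp
  qed
  ultimately show "unrepeated n oc \<and> (\<forall>R. oc n = Some R \<longrightarrow> R \<notin> contents n oc)"
    by blast
next
  assume "unrepeated n oc \<and> (\<forall>R. oc n = Some R \<longrightarrow> R \<notin> contents n oc)"
  then show "unrepeated (Suc n) oc"
    by (auto simp: unrepeated_def contents_def less_Suc_eq)
qed

text \<open>If nothing is dropped, \<open>Y\<close> had fewer than \<open>k\<close> elements and
  hence was all of \<open>S\<close>. Otherwise \<open>Y\<close> had exactly \<open>k\<close>. Old
  members of \<open>Y'\<close> already dominate \<open>S - Y\<close>; if \<open>R\<close> is kept,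
  then \<open>R'\<close> comes from \<open>Y\<close>, and its grade lies between those of
  \<open>S - Y\<close> and that of \<open>R\<close>.\<close>

lemma highest_drop_lowest:
  assumes highest: "highest k f S Y" and fin: "finite S"
    and Y': "Y' \<subseteq> insert R Y" "card Y' \<le> k" and new: "R \<notin> Y"
    and dropped: "insert R Y - Y' \<subseteq> {R'}"
    and lowest: "\<And>a. R' \<in> insert R Y - Y' \<Longrightarrow> a \<in> Y' \<Longrightarrow> f R' \<le> f a"
    and full: "insert R Y - Y' = {} \<or> card Y' = k"
  shows "highest k f (insert R S) Y'"
proof -
  have YS: "Y \<subseteq> S" "card Y = min k (card S)" and best: "\<And>a b. a \<in> Y \<Longrightarrow> b \<in> S - Y \<Longrightarrow> f b \<le> f a"
    using highest by (auto simp: highest_def)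
  have finY: "finite Y"
    using YS(1) fin by (rule finite_subset)
  show ?thesis
  proof (cases "insert R Y - Y' = {}")
    case True
    then have eq: "Y' = insert R Y"
      using Y'(1) by blast
    then have "card Y < k"
      using Y'(2) new finY by simp
    then have "Y = S"
      using YS fin by (intro card_subset_eq) auto
    then show ?thesis
      using eq Y'(2) by (simp add: highest_def)
  next
    case False
    then have card: "card Y' = k" and R': "R' \<in> insert R Y" "R' \<notin> Y'" and eq: "Y' = insert R Y - {R'}"
      using full dropped Y'(1) by auto
    have "card (insert R Y) = Suc k"
      using R' card finY eq by (metis card_Suc_Diff1 finite.insertI)
    then have cardY: "card Y = k"
      using new finY by simp
    have "k \<le> card (insert R S)"
      using YS(1,2) cardY fin card_mono[of "insert R S" Y] by auto
    moreover have "f b \<le> f a" if a: "a \<in> Y'" and b: "b \<in> insert R S - Y'" for a b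
    proof (cases "b = R'")
      case True
      then show ?thesis
        using lowest a R' by blast
    next
      case b': False
      then have b'': "b \<in> S - Y"
        using b eq by blast
      show ?thesis
      proof (cases "a = R")
        case True
        then have "R' \<in> Y"
          using R' a by auto
        then have "f b \<le> f R'"
          using best b'' by blast
        also have "\<dots> \<le> f a"
          using lowest a R' by blast
        finally show ?thesis .
      next
        case False
        then show ?thesis
          using best b'' a Y'(1) by blast
      qed
    qed
    ultimately show ?thesis
      using Y'(1) YS(1) card by (auto simp: highest_def)
  qed
qed

lemma highest_seen_again:
  assumes "highest k f S Y" "R \<in> Y"
  shows "highest k f (insert R S) Y"
  using assms by (simp add: highest_def insert_absorb subset_iff)

text \<open>Once \<open>Y\<close> has \<open>k\<close> elements, a member below
  \<open>\<tau>\<close> would bound everything in \<open>S - Y\<close>, leaving all objects that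
  reach \<open>\<tau>\<close> in a proper subset of \<open>Y\<close>. This replaces a count over the
  unbounded history by a check of the buffer.\<close>

lemma highest_reach_iff:
  assumes "highest k f S Y" "finite S"
  shows "k \<le> card {R \<in> S. \<tau> \<le> f R} \<longleftrightarrow> card Y = k \<and> (\<forall>R\<in>Y. \<tau> \<le> f R)"
proof
  have Y: "Y \<subseteq> S" "card Y = min k (card S)" and best: "\<And>a b. a \<in> Y \<Longrightarrow> b \<in> S - Y \<Longrightarrow> f b \<le> f a"
    using assms(1) by (auto simp: highest_def)
  assume k: "k \<le> card {R \<in> S. \<tau> \<le> f R}"
  also have "\<dots> \<le> card S"
    using assms(2) by (intro card_mono) auto
  finally have cardY: "card Y = k"
    using Y(2) by simp
  moreover have "\<tau> \<le> f R" if R: "R \<in> Y" for R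
  proof (rule ccontr)
    assume "\<not> \<tau> \<le> f R"
    then have "{R \<in> S. \<tau> \<le> f R} \<subset> Y"
      using best[OF R] R by force
    then have "card {R \<in> S. \<tau> \<le> f R} < card Y"
      using Y(1) assms(2) by (intro psubset_card_mono) (auto intro: finite_subset)
    then show False
      using k cardY by simp
  qed
  ultimately show "card Y = k \<and> (\<forall>R\<in>Y. \<tau> \<le> f R)"
    by blast
next
  assume "card Y = k \<and> (\<forall>R\<in>Y. \<tau> \<le> f R)"
  moreover from this have "Y \<subseteq> {R \<in> S. \<tau> \<le> f R}"
    using assms(1) by (auto simp: highest_def)
  ultimately show "k \<le> card {R \<in> S. \<tau> \<le> f R}"
    using card_mono[of "{R \<in> S. \<tau> \<le> f R}" Y] assms(2) by simp
qed

section \<open>One pass of a new object through the buffer\<close>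

definition swap_com :: "nat \<Rightarrow> nat \<Rightarrow> com" where
  "swap_com k a = SEQS [COPY_OBJECT a (Suc k), COPY_OBJECT k a, COPY_OBJECT (Suc k) k,
                        COPY_GRADE a (Suc k), COPY_GRADE k a, COPY_GRADE (Suc k) k]"

text \<open>The test succeeds on an empty cell \<open>a\<close>, so that the carried object is stored there; from then on
  the cell \<open>k\<close> is empty and nothing happens any more.\<close>

definition bubble_com :: "nat \<Rightarrow> com" where
  "bubble_com k = SEQS (map (\<lambda>a. IF (Conj (Used k) (Neg (Grade_Le k a))) (swap_com k a) SKIP) [0..<k])"

text \<open>Without the membership test an object seen again could occupy two cells. An empty cell
  never equals the carried object, so it does not block it.\<close>

definition remember_com :: "nat \<Rightarrow> com" where
  "remember_com k =
     IF (conj_tests (Used k) (map (\<lambda>a. Neg (Same_Object k a)) [0..<k])) (bubble_com k) SKIP"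

text \<open>Through \<open>map_option\<close> a grade cell is empty exactly when its object cell is.
  A comparison therefore fails on an empty buffer cell, which both the exchange test and the halting
  test exploit.\<close>

definition graded :: "nat \<Rightarrow> ('o \<Rightarrow> real) \<Rightarrow> 'o store \<Rightarrow> bool" where
  "graded n f s \<longleftrightarrow> (\<forall>a<n. gcells s a = map_option f (ocells s a))"

lemma run_swap:
  assumes "a < k"
  shows "run t db (swap_com k a) s []
     (s\<lparr>ocells := (ocells s)(Suc k := ocells s a, a := ocells s k, k := ocells s a),
        gcells := (gcells s)(Suc k := gcells s a, a := gcells s k, k := gcells s a)\<rparr>)"
proof -
  note copy = exec_single[OF Copy_Object] exec_single[OF Copy_Grade]
  \<comment> \<open>The final store stays unknown until all copies are executed and is only then
    identified with the stated one. The empty lists belong to the six copies and the closing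
    \<open>SKIP\<close>.\<close>
  have "\<exists>s'. run t db (swap_com k a) s ([] @ [] @ [] @ [] @ [] @ [] @ []) s' \<and> s' =
     (s\<lparr>ocells := (ocells s)(Suc k := ocells s a, a := ocells s k, k := ocells s a),
        gcells := (gcells s)(Suc k := gcells s a, a := gcells s k, k := gcells s a)\<rparr>)"
    unfolding swap_com_def SEQS_simps
    by (intro exI conjI, (rule run_SEQ, rule copy)+, rule exec.refl) (use assms in simp)
  then show ?thesis
    by simp
qed

text \<open>While cell \<open>k\<close> is occupied, its grade is at most that of every cell passed
  so far; exchanges never increase it, so earlier comparisons persist. They only permute the first
  \<open>k + 1\<close> cells. An object left in cell \<open>k\<close> at the end witnesses that all
  buffer cells are occupied.\<close>

lemma run_bubble:
  fixes s :: "'o store"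
  assumes "graded (Suc k) f s" "unrepeated (Suc k) (ocells s)"
  shows "\<exists>s'. run t db (bubble_com k) s [] s' \<and> pointers s' = pointers s \<and>
    (\<forall>b>Suc k. gcells s' b = gcells s b) \<and> graded (Suc k) f s' \<and> unrepeated (Suc k) (ocells s') \<and>
    contents (Suc k) (ocells s') = contents (Suc k) (ocells s) \<and>
    (\<forall>R b. ocells s' k = Some R \<longrightarrow> b < k \<longrightarrow> (\<exists>R'. ocells s' b = Some R' \<and> f R \<le> f R'))"
proof -
  define I where "I = (\<lambda>a es s'. es = ([] :: 'o event list) \<and> pointers s' = pointers s \<and>
    (\<forall>b>Suc k. gcells s' b = gcells s b) \<and> graded (Suc k) f s' \<and> unrepeated (Suc k) (ocells s') \<and>
    contents (Suc k) (ocells s') = contents (Suc k) (ocells s) \<and>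
    (\<forall>R b. ocells s' k = Some R \<longrightarrow> b < a \<longrightarrow> (\<exists>R'. ocells s' b = Some R' \<and> f R \<le> f R')))"
  have "\<exists>es s'. run t db (bubble_com k) s es s' \<and> I k es s'"
    unfolding bubble_com_def
  proof (rule run_SEQS_upt)
    show "I 0 [] s"
      using assms by (simp add: I_def)
  next
    fix a es and u :: "'o store"
    assume a: "a < k" and I: "I a es u"
    let ?p = "Conj (Used k) (Neg (Grade_Le k a))"
    have grd: "gcells u k = map_option f (ocells u k)" "gcells u a = map_option f (ocells u a)"
      using I a by (auto simp: I_def graded_def)
    show "\<exists>es' u'. run t db (IF ?p (swap_com k a) SKIP) u es' u' \<and> I (Suc a) (es @ es') u'"
    proof (cases "holds db u ?p")
      case False
      \<comment> \<open>A failing test means that cell \<open>k\<close> is empty, which makes the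
        claim vacuous, or that the comparison succeeded, which requires cell \<open>a\<close> to be
        occupied.\<close>
      have "I (Suc a) es u"
        using I False grd a unfolding I_def by (auto simp: less_Suc_eq)
      then show ?thesis
        using run_IF(2)[OF False exec.refl] by (metis append_Nil2)
    next
      case True
      let ?oc = "(ocells u)(Suc k := ocells u a, a := ocells u k, k := ocells u a)"
      let ?gc = "(gcells u)(Suc k := gcells u a, a := gcells u k, k := gcells u a)"
      obtain R where R: "ocells u k = Some R"
        using True by auto
      have less: "f R' \<le> f R" if "ocells u a = Some R'" for R'
        using True R grd that by auto
      \<comment> \<open>The transposition of \<open>a\<close> and \<open>k\<close>: as an involution
        on the first \<open>k + 1\<close> cells it preserves both the contents and the absence of
        repetitions.\<close>
      define p where "p = (\<lambda>b. if b = a then k else if b = k then a else b)"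
      have p: "p b < Suc k" "p (p b) = b" "?oc b = ocells u (p b)" if "b < Suc k" for b
        using that a by (auto simp: p_def)
      have "graded (Suc k) f (u\<lparr>ocells := ?oc, gcells := ?gc\<rparr>)"
        using I a grd by (auto simp: I_def graded_def)
      moreover have "unrepeated (Suc k) ?oc"
        using I p unfolding I_def unrepeated_def by metis
      moreover have "contents (Suc k) ?oc = contents (Suc k) (ocells u)"
        using p unfolding contents_def by metis
      moreover have "\<exists>R''. ?oc b = Some R'' \<and> f R' \<le> f R''"
        if "?oc k = Some R'" "b < Suc a" for R' b
      proof (cases "b = a")
        case True
        then show ?thesis
          using a R less that by auto
      next
        case False
        then have "b < a"
          using that by simp
        then obtain R'' where "ocells u b = Some R''" "f R \<le> f R''"
          using I R unfolding I_def by blast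
        moreover have "f R' \<le> f R"
          using less that by auto
        ultimately show ?thesis
          using False that a by auto
      qed
      ultimately have "I (Suc a) (es @ []) (u\<lparr>ocells := ?oc, gcells := ?gc\<rparr>)"
        using I a unfolding I_def by simp
      then show ?thesis
        using run_IF(1)[OF True run_swap[OF a]] by blast
    qed
  qed
  then show ?thesis
    unfolding I_def by blast
qed

text \<open>The first \<open>k\<close> cells hold \<open>Y\<close>; the cells \<open>k\<close> and \<open>Suc k\<close> are scratch space.\<close>

definition buffers :: "nat \<Rightarrow> ('o \<Rightarrow> real) \<Rightarrow> 'o store \<Rightarrow> 'o set \<Rightarrow> bool" where
  "buffers k f s Y \<longleftrightarrow> graded k f s \<and> unrepeated k (ocells s) \<and> contents k (ocells s) = Y"

text \<open>For an object not yet remembered, the pass acts on the \<open>k + 1\<close> cells formed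
  by the buffer and the carried object; whatever remains in cell \<open>k\<close> is the one
  dropped. Grade cells above \<open>Suc k\<close> must survive because the threshold is computed
  from some of them.\<close>

lemma run_remember:
  assumes highest: "highest k f S Y" and fin: "finite S"
    and buffers: "buffers k f s Y" and cur: "ocells s k = Some R" "gcells s k = Some (f R)"
  shows "\<exists>s' Y'. run t db (remember_com k) s [] s' \<and> pointers s' = pointers s \<and>
    (\<forall>b>Suc k. gcells s' b = gcells s b) \<and> buffers k f s' Y' \<and>
    highest k f (insert R S) Y' \<and> Y' \<subseteq> insert R Y"
proof -
  let ?p = "conj_tests (Used k) (map (\<lambda>a. Neg (Same_Object k a)) [0..<k])"
  have p: "holds db s ?p \<longleftrightarrow> R \<notin> Y"
    using cur(1) buffers by (auto simp: holds_conj_tests buffers_def contents_def)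
  show ?thesis
  proof (cases "R \<in> Y")
    case True
    then have "run t db (remember_com k) s [] s"
      unfolding remember_com_def using p by (intro run_IF(2) exec.refl) simp
    then show ?thesis
      using buffers highest_seen_again[OF highest True] by blast
  next
    case False
    have "graded (Suc k) f s"
      using buffers cur by (auto simp: buffers_def graded_def less_Suc_eq)
    moreover have "unrepeated (Suc k) (ocells s)"
      using buffers cur(1) False by (simp add: buffers_def unrepeated_Suc)
    ultimately obtain s' where s': "run t db (bubble_com k) s [] s'" "pointers s' = pointers s"
        "\<forall>b>Suc k. gcells s' b = gcells s b" "graded (Suc k) f s'" "unrepeated (Suc k) (ocells s')"
      and all: "contents (Suc k) (ocells s') = contents (Suc k) (ocells s)"
      and low: "\<And>R b. ocells s' k = Some R \<Longrightarrow> b < k \<Longrightarrow> \<exists>R'. ocells s' b = Some R' \<and> f R \<le> f R'"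
      using run_bubble[of k f s t db] by blast
    let ?Y = "contents k (ocells s')"
    have unr: "unrepeated k (ocells s')"
      using s'(5) by (simp add: unrepeated_Suc)
    have all': "insert R Y = (case ocells s' k of None \<Rightarrow> ?Y | Some R' \<Rightarrow> insert R' ?Y)"
      using all buffers cur(1) by (simp add: contents_Suc buffers_def)
    have "highest k f (insert R S) ?Y"
    \<comment> \<open>When cell \<open>k\<close> is empty, \<open>the\<close> is unspecified, but
      then nothing is dropped and the claims about \<open>R'\<close> hold trivially.\<close>
    proof (rule highest_drop_lowest[OF highest fin _ _ False, where R' = "the (ocells s' k)"])
      show "?Y \<subseteq> insert R Y" "insert R Y - ?Y \<subseteq> {the (ocells s' k)}"
        using all' by (auto split: option.splits)
      show "card ?Y \<le> k"
        using unr by (rule card_contents_le)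
      show "f (the (ocells s' k)) \<le> f a" if R'': "the (ocells s' k) \<in> insert R Y - ?Y" and a: "a \<in> ?Y" for a
      proof -
        obtain R' where R': "ocells s' k = Some R'"
          using R'' unfolding all' by (auto split: option.splits)
        moreover obtain b where "b < k" "ocells s' b = Some a"
          using a by (auto simp: contents_def)
        ultimately show ?thesis
          using low by fastforce
      qed
      show "insert R Y - ?Y = {} \<or> card ?Y = k"
      proof (cases "ocells s' k")
        case None
        then show ?thesis
          using all' by simp
      next
        case (Some R')
        then have "{..<k} \<subseteq> dom (ocells s')"
          using low by fastforce
        then show ?thesis
          using card_contents_full[OF unr] by blast
      qed
    qed
    moreover have "?Y \<subseteq> insert R Y"
      using all' by (auto split: option.splits)
    moreover have "buffers k f s' ?Y"
      using s'(4) unr by (simp add: buffers_def graded_def)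
    moreover have "run t db (remember_com k) s [] s'"
      unfolding remember_com_def using p False s'(1) by (intro run_IF(1)) simp_all
    ultimately show ?thesis
      using s'(2,3) by blast
  qed
qed


section \<open>The program\<close>

text \<open>The grade cells from \<open>k + 2\<close> on hold the \<open>m\<close> grades of the current object; those from
  \<open>k + 2 + m\<close> on hold the \<open>m\<close> grades last seen under sorted access.\<close>

definition visit_com :: "nat \<Rightarrow> nat \<Rightarrow> nat \<Rightarrow> com" where
  "visit_com m k i = SEQS
     [READ i k (k + 2 + m + i),
      SEQS (map (\<lambda>j. if j = i then SKIP else LOOKUP j k (k + 2 + j)) [0..<m]),
      AGGREGATE (map (\<lambda>j. if j = i then k + 2 + m + i else k + 2 + j) [0..<m]) k,
      remember_com k]"

text \<open>The threshold goes to the scratch cell \<open>Suc k\<close>: exchanges use it only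
  during visits, so it is intact when the loop test reads it.\<close>

definition round_com :: "nat \<Rightarrow> nat \<Rightarrow> com" where
  "round_com m k = SEQ (SEQS (map (visit_com m k) [0..<m]))
     (AGGREGATE (map (\<lambda>i. k + 2 + m + i) [0..<m]) (Suc k))"

text \<open>List \<open>0\<close> stands for all lists, since they have equal length and are read in
  step.\<close>

definition continue_test :: "nat \<Rightarrow> test" where
  "continue_test k = Conj (More_Entries 0)
     (Neg (conj_tests (More_Entries 0) (map (Grade_Le (Suc k)) [0..<k])))"

definition output_com :: "nat \<Rightarrow> com" where
  "output_com k = SEQS (map (\<lambda>a. IF (Used a) (OUTPUT a a) SKIP) [0..<k])"

text \<open>The first round is unconditional because the test reads a threshold that only a round
  computes.\<close>

definition rounds_com :: "nat \<Rightarrow> nat \<Rightarrow> com" where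
  "rounds_com m k = SEQ (round_com m k) (WHILE (continue_test k) (round_com m k))"

definition ta_com :: "nat \<Rightarrow> nat \<Rightarrow> com" where
  "ta_com m k = SEQ (rounds_com m k) (output_com k)"


section \<open>Correctness of the program\<close>

text \<open>The rules of \<open>ta_visits\<close> extend a sequence at the front, whereas the loop
  invariant over the lists grows at the end.\<close>

lemma ta_visits_snoc:
  "ta_visits t m k db d is \<sigma> es \<sigma>' \<Longrightarrow> ta_visit t m k db d i \<sigma>' es' \<sigma>'' \<Longrightarrow>
   ta_visits t m k db d (is @ [i]) \<sigma> (es @ es') \<sigma>''"
proof (induction rule: ta_visits.induct)
  case (1 \<sigma>)
  then show ?case
    using ta_visits.intros(2)[OF _ ta_visits.intros(1)] by fastforce
next
  case (2 i \<sigma> es \<sigma>' "is" es' \<sigma>'')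
  then show ?case
    using ta_visits.intros(2)[of t m k db d i \<sigma> es \<sigma>'] by simp
qed

lemma buffers_cong:
  "buffers k f s Y \<Longrightarrow> (\<And>a. a < k \<Longrightarrow> ocells s' a = ocells s a) \<Longrightarrow>
   (\<And>a. a < k \<Longrightarrow> gcells s' a = gcells s a) \<Longrightarrow> buffers k f s' Y"
  unfolding buffers_def graded_def unrepeated_def contents_def by auto

text \<open>The specification leaves the order of the outputs open; the order of the cells provides
  \<open>Rs\<close>.\<close>

lemma run_output:
  fixes s :: "'o store"
  assumes "buffers k f s Y"
  shows "\<exists>Rs. run t db (output_com k) s (map (\<lambda>R. Output R (f R)) Rs) s \<and> distinct Rs \<and> set Rs = Y"
proof -
  define I where "I = (\<lambda>a es s'. s' = s \<and> (\<exists>Rs. es = map (\<lambda>R. Output R (f R)) Rs \<and>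
    distinct Rs \<and> set Rs = contents a (ocells s)))"
  have s: "graded k f s" "unrepeated k (ocells s)" "contents k (ocells s) = Y"
    using assms by (simp_all add: buffers_def)
  have "\<exists>es s'. run t db (output_com k) s es s' \<and> I k es s'"
    unfolding output_com_def
  proof (rule run_SEQS_upt)
    show "I 0 [] s"
      by (simp add: I_def contents_def)
  next
    fix a es s'
    assume a: "a < k" and "I a es s'"
    then obtain Rs where s': "s' = s" and es: "es = map (\<lambda>R. Output R (f R)) Rs"
      and Rs: "distinct Rs" "set Rs = contents a (ocells s)"
      by (auto simp: I_def)
    show "\<exists>es' u. run t db (IF (Used a) (OUTPUT a a) SKIP) s' es' u \<and> I (Suc a) (es @ es') u"
    proof (cases "ocells s a")
      case None
      then have "I (Suc a) (es @ []) s"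
        using es Rs by (auto simp: I_def contents_Suc)
      moreover have "run t db (IF (Used a) (OUTPUT a a) SKIP) s [] s"
        using None by (intro run_IF(2) exec.refl) simp
      ultimately show ?thesis
        using s' by blast
    next
      case (Some R)
      have "unrepeated (Suc a) (ocells s)"
        using s(2) a by (simp add: unrepeated_def)
      then have "R \<notin> contents a (ocells s)"
        using Some by (simp add: unrepeated_Suc)
      then have "I (Suc a) (es @ [Output R (f R)]) s"
        unfolding I_def using es Rs Some by (intro conjI exI[of _ "Rs @ [R]"]) (auto simp: contents_Suc)
      moreover have "gcells s a = Some (f R)"
        using s(1) a Some by (simp add: graded_def)
      then have "run t db (IF (Used a) (OUTPUT a a) SKIP) s [Output R (f R)] s"
        using Some by (intro run_IF(1) exec_single Output) simp_all
      ultimately show ?thesis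
        using s' by blast
    qed
  qed
  then show ?thesis
    using s(3) unfolding I_def by blast
qed

text \<open>Skipping \<open>i\<close> mirrors the filter in \<open>ta_visit\<close>. The preserved
  grade cells are the buffer and scratch space below, and the grades last seen under sorted access
  above.\<close>

lemma run_lookups:
  fixes s :: "'o store"
  assumes "ocells s k = Some R" "length (slists db) = m"
  shows "\<exists>s'. run t db (SEQS (map (\<lambda>j. if j = i then SKIP else LOOKUP j k (k + 2 + j)) [0..<m])) s
      (map (\<lambda>j. Random_Access j R (grade db R j)) (filter (\<lambda>j. j \<noteq> i) [0..<m])) s' \<and>
    pointers s' = pointers s \<and> ocells s' = ocells s \<and>
    (\<forall>b. b < k + 2 \<or> k + 2 + m \<le> b \<longrightarrow> gcells s' b = gcells s b) \<and>
    (\<forall>j<m. j \<noteq> i \<longrightarrow> gcells s' (k + 2 + j) = Some (grade db R j))"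
proof -
  define I where "I = (\<lambda>n es (s' :: 'o store).
    es = map (\<lambda>j. Random_Access j R (grade db R j)) (filter (\<lambda>j. j \<noteq> i) [0..<n]) \<and>
    pointers s' = pointers s \<and> ocells s' = ocells s \<and>
    (\<forall>b. b < k + 2 \<or> k + 2 + m \<le> b \<longrightarrow> gcells s' b = gcells s b) \<and>
    (\<forall>j<n. j \<noteq> i \<longrightarrow> gcells s' (k + 2 + j) = Some (grade db R j)))"
  have "\<exists>es s'. run t db (SEQS (map (\<lambda>j. if j = i then SKIP else LOOKUP j k (k + 2 + j)) [0..<m])) s es s' \<and>
      I m es s'"
  proof (rule run_SEQS_upt)
    show "I 0 [] s"
      by (simp add: I_def)
  next
    fix j es and u :: "'o store"
    assume j: "j < m" and I: "I j es u"
    show "\<exists>es' u'. run t db (if j = i then SKIP else LOOKUP j k (k + 2 + j)) u es' u' \<and> I (Suc j) (es @ es') u'"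
    proof (cases "j = i")
      case True
      then have "I (Suc j) (es @ []) u"
        using I by (auto simp: I_def less_Suc_eq)
      then show ?thesis
        using True exec.refl by (metis (full_types))
    next
      case False
      let ?u = "u\<lparr>gcells := (gcells u)(k + 2 + j \<mapsto> grade db R j)\<rparr>"
      have "I (Suc j) (es @ [Random_Access j R (grade db R j)]) ?u"
        using I False j by (auto simp: I_def less_Suc_eq)
      moreover have "run t db (LOOKUP j k (k + 2 + j)) u [Random_Access j R (grade db R j)] ?u"
        using I assms j by (intro exec_single Lookup) (auto simp: I_def)
      ultimately show ?thesis
        using False by auto
    qed
  qed
  then show ?thesis
    unfolding I_def by blast
qed

section \<open>Simulation of the algorithm on a fixed database\<close>

locale ta_database =
  fixes t :: "real list \<Rightarrow> real" and m k :: nat and db :: "'o database"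
  assumes db: "is_database m db" and m: "1 \<le> m" and k: "1 \<le> k" "k \<le> card (objects db)"
begin

abbreviation f :: "'o \<Rightarrow> real" where
  "f \<equiv> overall t m db"

lemma length_slists: "length (slists db) = m"
  using db by (simp add: is_database_def)

text \<open>Every object occurs exactly once in each list; this ties the exhaustion of a pointer to
  \<open>card (objects db)\<close>.\<close>

lemma length_slist:
  assumes "i < m"
  shows "length (slists db ! i) = card (objects db)"
proof -
  have "distinct (map fst (slists db ! i))"
    and set: "set (slists db ! i) = {(R, grade db R i) |R. R \<in> objects db}"
    using db assms by (simp_all add: is_database_def)
  then have "length (slists db ! i) = card (set (map fst (slists db ! i)))"
    using distinct_card by fastforce
  also have "set (map fst (slists db ! i)) = objects db"
    using set by (force simp: image_iff)
  finally show ?thesis .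
qed

lemma entry:
  assumes "i < m" "d < card (objects db)" "slists db ! i ! d = (R, x)"
  shows "R \<in> objects db" "x = grade db R i"
proof -
  have "(R, x) \<in> set (slists db ! i)"
    using assms length_slist nth_mem by metis
  then show "R \<in> objects db" "x = grade db R i"
    using db assms(1) by (auto simp: is_database_def)
qed

lemma grade_bounds: "R \<in> objects db \<Longrightarrow> i < m \<Longrightarrow> grade db R i \<in> {0..1}"
  using db by (auto simp: is_database_def)

lemma run_aggregate:
  assumes "length bs = m" "\<And>j. j < m \<Longrightarrow> gcells s (bs ! j) = Some (x j)" "\<And>j. j < m \<Longrightarrow> x j \<in> {0..1}"
  shows "run t db (AGGREGATE bs b) s [] (s\<lparr>gcells := (gcells s)(b \<mapsto> t (map x [0..<m]))\<rparr>)"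
proof (rule exec_single, rule Aggregate)
  show "length bs = length (slists db)"
    using assms(1) by (simp add: length_slists)
  show "map (gcells s) bs = map Some (map x [0..<m])"
    using assms(1,2) by (intro nth_equalityI) auto
  show "set (map x [0..<m]) \<subseteq> {0..1}"
    using assms(3) by auto
qed

text \<open>The simulation relation between a state of the specification and a store. The history
  \<open>S\<close> has no counterpart in the store and exists only in the proof.\<close>

definition buffered_history :: "'o set \<Rightarrow> 'o set \<Rightarrow> 'o store \<Rightarrow> bool" where
  "buffered_history S Y s \<longleftrightarrow> finite S \<and> highest k f S Y \<and> buffers k f s Y"

text \<open>The grade read by sorted access stays in cell \<open>k + 2 + m + i\<close>, where it
  serves both this aggregation and the later threshold; the cells of the other lists must survive
  for the same purpose.\<close>

lemma run_visit:
  assumes i: "i < m" and d: "d < card (objects db)" and hist: "buffered_history S Y s"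
    and ptr: "length (pointers s) = m" "pointers s ! i = d"
  shows "\<exists>es s' S' Y'. run t db (visit_com m k i) s es s' \<and> ta_visit t m k db d i (S, Y) es (S', Y') \<and>
    buffered_history S' Y' s' \<and> pointers s' = (pointers s)[i := Suc d] \<and>
    gcells s' (k + 2 + m + i) = Some (snd (slists db ! i ! d)) \<and>
    (\<forall>j. j \<noteq> i \<longrightarrow> gcells s' (k + 2 + m + j) = gcells s (k + 2 + m + j))"
proof -
  obtain R x where Rx: "slists db ! i ! d = (R, x)"
    by fastforce
  note R = entry[OF i d Rx]
  let ?lookups = "map (\<lambda>j. Random_Access j R (grade db R j)) (filter (\<lambda>j. j \<noteq> i) [0..<m])"
  define s1 where "s1 = s\<lparr>pointers := (pointers s)[i := Suc d], ocells := (ocells s)(k \<mapsto> R),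
    gcells := (gcells s)(k + 2 + m + i \<mapsto> x)\<rparr>"
  have run1: "run t db (READ i k (k + 2 + m + i)) s [Sorted_Access i R x] s1"
    unfolding s1_def using i d ptr Rx length_slist by (intro exec_single Read) simp_all
  have "ocells s1 k = Some R"
    by (simp add: s1_def)
  from run_lookups[OF this length_slists]
  obtain s2 where run2: "run t db (SEQS (map (\<lambda>j. if j = i then SKIP else LOOKUP j k (k + 2 + j)) [0..<m]))
      s1 ?lookups s2"
    and s2: "pointers s2 = pointers s1" "ocells s2 = ocells s1"
      "\<And>b. b < k + 2 \<or> k + 2 + m \<le> b \<Longrightarrow> gcells s2 b = gcells s1 b"
      "\<And>j. j < m \<Longrightarrow> j \<noteq> i \<Longrightarrow> gcells s2 (k + 2 + j) = Some (grade db R j)"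
    by blast
  define s3 where "s3 = s2\<lparr>gcells := (gcells s2)(k \<mapsto> f R)\<rparr>"
  have run3: "run t db (AGGREGATE (map (\<lambda>j. if j = i then k + 2 + m + i else k + 2 + j) [0..<m]) k) s2 [] s3"
    unfolding s3_def overall_def
  proof (rule run_aggregate)
    \<comment> \<open>For \<open>j = i\<close> the operand is the grade from sorted access, which
      equals \<open>grade db R i\<close> by \<open>entry\<close>.\<close>
    show "gcells s2 (map (\<lambda>j. if j = i then k + 2 + m + i else k + 2 + j) [0..<m] ! j) = Some (grade db R j)"
      if "j < m" for j
      using that s2(3)[of "k + 2 + m + i"] s2(4)[of j] R(2) by (simp add: s1_def)
  qed (use R(1) grade_bounds in simp_all)
  have "buffers k f s3 Y"
    by (rule buffers_cong[of k f s]) (use hist s2 in \<open>simp_all add: buffered_history_def s3_def s1_def\<close>)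
  then obtain s4 Y' where run4: "run t db (remember_com k) s3 [] s4" and s4: "pointers s4 = pointers s3"
      "\<And>b. b > Suc k \<Longrightarrow> gcells s4 b = gcells s3 b"
    and Y': "buffers k f s4 Y'" "highest k f (insert R S) Y'" "Y' \<subseteq> insert R Y"
    using run_remember[of k f S Y s3 R t db] hist s2(2) by (auto simp: buffered_history_def s3_def s1_def)
  have "run t db (visit_com m k i) s ([Sorted_Access i R x] @ ?lookups @ [] @ [] @ []) s4"
    unfolding visit_com_def SEQS_simps
    by (rule run_SEQ[OF run1] run_SEQ[OF run2] run_SEQ[OF run3] run_SEQ[OF run4] exec.refl)+
  moreover have "ta_visit t m k db d i (S, Y) (Sorted_Access i R x # ?lookups) (insert R S, Y')"
    using Rx Y'(2,3) by (rule ta_visit.intros)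
  moreover have "buffered_history (insert R S) Y' s4"
    using hist Y' by (simp add: buffered_history_def)
  moreover have "gcells s4 (k + 2 + m + j) = gcells s1 (k + 2 + m + j)" for j
    using s4(2) s2(3) by (simp add: s3_def)
  moreover have "pointers s4 = (pointers s)[i := Suc d]"
    using s4(1) s2(1) by (simp add: s3_def s1_def)
  ultimately show ?thesis
    by (intro exI[of _ "Sorted_Access i R x # ?lookups"] exI[of _ s4] exI[of _ "insert R S"] exI[of _ Y'])
      (simp add: s1_def Rx)
qed

lemma run_round:
  assumes d: "d < card (objects db)" and hist: "buffered_history S Y s" and ptr: "pointers s = replicate m d"
  shows "\<exists>es s' S' Y'. run t db (round_com m k) s es s' \<and>
    ta_visits t m k db d [0..<m] (S, Y) es (S', Y') \<and> buffered_history S' Y' s' \<and>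
    pointers s' = replicate m (Suc d) \<and> gcells s' (Suc k) = Some (threshold t m db d)"
proof -
  \<comment> \<open>Within a round the lists below \<open>i\<close> are already one entry further,
    and their grades are collected for the threshold.\<close>
  define I where "I = (\<lambda>i es u. \<exists>S' Y'. ta_visits t m k db d [0..<i] (S, Y) es (S', Y') \<and>
    buffered_history S' Y' u \<and> length (pointers u) = m \<and>
    (\<forall>j<m. pointers u ! j = (if j < i then Suc d else d)) \<and>
    (\<forall>j<i. gcells u (k + 2 + m + j) = Some (snd (slists db ! j ! d))))"
  have "\<exists>es u. run t db (SEQS (map (visit_com m k) [0..<m])) s es u \<and> I m es u"
  proof (rule run_SEQS_upt)
    show "I 0 [] s"
      using hist ptr by (auto simp: I_def intro: ta_visits.intros)
  next
    fix i es u
    assume i: "i < m" and "I i es u"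
    then obtain S1 Y1 where visits: "ta_visits t m k db d [0..<i] (S, Y) es (S1, Y1)"
      and u: "buffered_history S1 Y1 u" "length (pointers u) = m"
        "\<And>j. j < m \<Longrightarrow> pointers u ! j = (if j < i then Suc d else d)"
        "\<And>j. j < i \<Longrightarrow> gcells u (k + 2 + m + j) = Some (snd (slists db ! j ! d))"
      unfolding I_def by blast
    have "pointers u ! i = d"
      using u(3) i by simp
    from run_visit[OF i d u(1,2) this] obtain es' u' S' Y'
      where run: "run t db (visit_com m k i) u es' u'" and visit: "ta_visit t m k db d i (S1, Y1) es' (S', Y')"
      and u': "buffered_history S' Y' u'" "pointers u' = (pointers u)[i := Suc d]"
        "gcells u' (k + 2 + m + i) = Some (snd (slists db ! i ! d))"
        "\<And>j. j \<noteq> i \<Longrightarrow> gcells u' (k + 2 + m + j) = gcells u (k + 2 + m + j)"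
      by blast
    have "ta_visits t m k db d [0..<Suc i] (S, Y) (es @ es') (S', Y')"
      using ta_visits_snoc[OF visits visit] by simp
    moreover have "pointers u' ! j = (if j < Suc i then Suc d else d)" if "j < m" for j
      using u'(2) u(2) u(3)[OF that] that by (cases "j = i") auto
    moreover have "gcells u' (k + 2 + m + j) = Some (snd (slists db ! j ! d))" if "j < Suc i" for j
      using u'(3) u'(4)[of j] u(4)[of j] that by (cases "j = i") auto
    ultimately have "I (Suc i) (es @ es') u'"
      unfolding I_def using u'(1,2) u(2) by auto
    then show "\<exists>es' u'. run t db (visit_com m k i) u es' u' \<and> I (Suc i) (es @ es') u'"
      using run by blast
  qed
  then obtain es u S' Y' where run1: "run t db (SEQS (map (visit_com m k) [0..<m])) s es u"
    and visits: "ta_visits t m k db d [0..<m] (S, Y) es (S', Y')"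
    and u: "buffered_history S' Y' u" "length (pointers u) = m" "\<And>j. j < m \<Longrightarrow> pointers u ! j = Suc d"
      "\<And>j. j < m \<Longrightarrow> gcells u (k + 2 + m + j) = Some (snd (slists db ! j ! d))"
    unfolding I_def by auto
  let ?u = "u\<lparr>gcells := (gcells u)(Suc k \<mapsto> threshold t m db d)\<rparr>"
  have run2: "run t db (AGGREGATE (map (\<lambda>i. k + 2 + m + i) [0..<m]) (Suc k)) u [] ?u"
    unfolding threshold_def
  proof (rule run_aggregate)
    show "snd (slists db ! j ! d) \<in> {0..1}" if "j < m" for j
      using entry[OF that d, of "fst (slists db ! j ! d)" "snd (slists db ! j ! d)"] grade_bounds that by simp
  qed (use u(4) in simp_all)
  have "buffered_history S' Y' ?u"
    using u(1) by (auto simp: buffered_history_def elim: buffers_cong)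
  moreover have "pointers ?u = replicate m (Suc d)"
    using u(2,3) by (auto intro: nth_equalityI)
  ultimately show ?thesis
    using run_SEQ[OF run1 run2] visits
    by (intro exI[of _ es] exI[of _ ?u] exI[of _ S'] exI[of _ Y']) (simp add: round_com_def)
qed

text \<open>The specification counts over \<open>S\<close> while the program inspects only the
  buffer; \<open>highest_reach_iff\<close> connects the two. Exhaustion shows in the pointer into
  list \<open>0\<close>.\<close>

lemma holds_continue_test:
  assumes hist: "buffered_history S Y s" and ptr: "pointers s = replicate m (Suc d)"
    and d: "d < card (objects db)" and thr: "gcells s (Suc k) = Some (threshold t m db d)"
  shows "holds db s (continue_test k) \<longleftrightarrow> \<not> ta_halts t m k db d S"
proof -
  let ?\<tau> = "threshold t m db d"
  have s: "graded k f s" "unrepeated k (ocells s)" "contents k (ocells s) = Y"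
    and S: "finite S" "highest k f S Y"
    using hist by (simp_all add: buffered_history_def buffers_def)
  have more: "holds db s (More_Entries 0) \<longleftrightarrow> Suc d \<noteq> card (objects db)"
    using m ptr d length_slist[of 0] by auto
  \<comment> \<open>A comparison with an empty cell is false, so passing all \<open>k\<close> of
    them also certifies a full buffer.\<close>
  have "(\<forall>a<k. holds db s (Grade_Le (Suc k) a)) \<longleftrightarrow> {..<k} \<subseteq> dom (ocells s) \<and> (\<forall>R\<in>Y. ?\<tau> \<le> f R)"
  proof
    assume le: "\<forall>a<k. holds db s (Grade_Le (Suc k) a)"
    then show "{..<k} \<subseteq> dom (ocells s) \<and> (\<forall>R\<in>Y. ?\<tau> \<le> f R)"
      using s(1,3) thr by (fastforce simp: graded_def contents_def)
  next
    assume R: "{..<k} \<subseteq> dom (ocells s) \<and> (\<forall>R\<in>Y. ?\<tau> \<le> f R)"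
    show "\<forall>a<k. holds db s (Grade_Le (Suc k) a)"
    proof (intro allI impI)
      fix a
      assume a: "a < k"
      then obtain R' where R': "ocells s a = Some R'"
        using R by blast
      then have "R' \<in> Y"
        using a s(3) by (auto simp: contents_def)
      then show "holds db s (Grade_Le (Suc k) a)"
        using R R' a s(1) thr by (simp add: graded_def)
    qed
  qed
  also have "\<dots> \<longleftrightarrow> k \<le> card {R \<in> S. ?\<tau> \<le> f R}"
    using highest_reach_iff[OF S(2,1)] card_contents_full[OF s(2)] s(3) by simp
  finally show ?thesis
    using more by (auto simp: continue_test_def holds_conj_tests ta_halts_def simp del: holds.simps(1,4))
qed

text \<open>Induction on the number of unread depths: the forced stop at the last entry ends the
  loop even if \<open>t\<close> is not monotone. The outputs \<open>es'\<close> are kept apart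
  because the program makes them after the loop, while \<open>ta_rounds\<close> attaches them to the
  last round.\<close>

lemma run_rounds:
  assumes "d < card (objects db)" "buffered_history S Y s" "pointers s = replicate m d"
  shows "\<exists>es s' es'. run t db (rounds_com m k) s es s' \<and> run t db (output_com k) s' es' s' \<and>
    ta_rounds t m k db d (S, Y) (es @ es')"
  using assms
proof (induction "card (objects db) - d" arbitrary: d S Y s rule: less_induct)
  case less
  obtain es u S' Y' where run: "run t db (round_com m k) s es u"
    and visits: "ta_visits t m k db d [0..<m] (S, Y) es (S', Y')"
    and hist: "buffered_history S' Y' u" and ptr: "pointers u = replicate m (Suc d)"
    and thr: "gcells u (Suc k) = Some (threshold t m db d)"
    using run_round[OF less.prems] by blast
  note continue = holds_continue_test[OF hist ptr less.prems(1) thr]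
  show ?case
  proof (cases "ta_halts t m k db d S'")
    case True
    have "run t db (rounds_com m k) s (es @ []) u"
      unfolding rounds_com_def using continue True by (intro run_SEQ[OF run] run_WHILE_False) simp
    moreover obtain Rs where "run t db (output_com k) u (map (\<lambda>R. Output R (f R)) Rs) u"
      and "distinct Rs" "set Rs = Y'"
      using run_output hist unfolding buffered_history_def by blast
    ultimately show ?thesis
      using ta_rounds.halt[OF visits True] by fastforce
  next
    case False
    then have d: "Suc d < card (objects db)"
      using less.prems(1) by (simp add: ta_halts_def)
    then have "card (objects db) - Suc d < card (objects db) - d"
      by simp
    from less.hyps[OF this d hist ptr] obtain es1 u1 es2 where run1: "run t db (rounds_com m k) u es1 u1"
      and out: "run t db (output_com k) u1 es2 u1" and rounds: "ta_rounds t m k db (Suc d) (S', Y') (es1 @ es2)"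
      by blast
    \<comment> \<open>Once its test succeeds, the loop unfolds to \<open>rounds_com m k\<close>, so
      the induction hypothesis covers the rest.\<close>
    have "run t db (rounds_com m k) s (es @ es1) u1"
      unfolding rounds_com_def
      using continue False run1 by (intro run_SEQ[OF run] run_WHILE_True) (simp_all add: rounds_com_def)
    moreover have "ta_rounds t m k db d (S, Y) ((es @ es1) @ es2)"
      using ta_rounds.continue[OF visits False rounds] by simp
    ultimately show ?thesis
      using out by blast
  qed
qed

lemma carries_out_TA_ta_com: "carries_out_TA t m k db (ta_com m k)"
proof -
  have "buffered_history {} {} (init_store m)"
    by (simp add: buffered_history_def highest_def buffers_def graded_def unrepeated_def contents_def
        init_store_def)
  moreover have "0 < card (objects db)" "pointers (init_store m) = replicate m 0"
    using k by (simp_all add: init_store_def)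
  ultimately obtain es s es' where "run t db (rounds_com m k) (init_store m) es s"
    and "run t db (output_com k) s es' s" "ta_run t m k db (es @ es')"
    unfolding ta_run_def using run_rounds by blast
  then show ?thesis
    unfolding carries_out_TA_def ta_com_def using run_SEQ by blast
qed

end

theorem theorem4p2:
  fixes m k :: nat and t :: "real list \<Rightarrow> real"
  assumes "1 \<le> m" and "1 \<le> k"
    and "\<And>xs. length xs = m \<Longrightarrow> set xs \<subseteq> {0..1} \<Longrightarrow> 0 \<le> t xs"
  shows "\<exists>(P :: com) (B :: nat). \<forall>db :: 'o database.
           is_database m db \<and> k \<le> card (objects db) \<longrightarrow>
             carries_out_TA t m k db P \<and>
             (\<forall>es c s. exec t db (P, init_store m) es (c, s) \<longrightarrow> stores_at_most B s)"
proof (intro exI allI impI conjI)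
  fix db :: "'o database"
  assume "is_database m db \<and> k \<le> card (objects db)"
  then interpret ta_database t m k db
    using assms(1,2) by unfold_locales auto
  \<comment> \<open>The witness for \<open>P\<close> depends on \<open>m\<close> and
    \<open>k\<close> alone.\<close>
  show "carries_out_TA t m k db (ta_com m k)"
    by (rule carries_out_TA_ta_com)
next
  fix db :: "'o database" and es c s
  assume "exec t db (ta_com m k, init_store m) es (c, s)"
  \<comment> \<open>The witness for \<open>B\<close> counts the \<open>m\<close> pointers and the
    target cells in the program text, hence is independent of the database.\<close>
  then show "stores_at_most (m + card (object_targets (ta_com m k)) + card (grade_targets (ta_com m k))) s"
    by (rule exec_stores_at_most)
qed

end
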